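(* Let $\widehat P_1,\dots,\widehat P_K$ ($K\ge 1$) be laws on $\mathbb R^d$, put $\widehat{\mathfrak P}=\{\widehat P_1,\dots,\widehat P_K\}$, fix $q_0\in\mathbb R^d\setminus\{0\}$, $r_f,r_0\in\mathbb R$ and $L>0$, and let $c_{\max}=L/\|q_0\|_1$. For $X^{(k)}\sim\widehat P_k$ set $\eta_k=q_0^\top(X^{(k)}-r_f\mathbf 1)$ and $\Gamma_k(c)=V_{\rm CPT}^{\widehat P_k}(r_f-r_0+c\,\eta_k)$ for $c\in[0,c_{\max}]$. Assume $0<c_{\max}<\infty$ and that every $\Gamma_k$ is finite and continuous on $[0,c_{\max}]$. Let $$\underline\Gamma(c)=\inf_{P\in\widehat{\mathfrak P}}V_{\rm CPT}^{P}\bigl(r_f-r_0+c\,q_0^\top(X-r_f\mathbf 1)\bigr),\qquad c\in[0,c_{\max}].$$ (i) For every $c\in[0,c_{\max}]$, $\underline\Gamma(c)=\min_{1\le k\le K}\Gamma_k(c)$, so the distributionally robust ray problem, i.e. the problem of maximizing over portfolios $x\in\{cq_0:0\le c\le c_{\max}\}$ the worst-case CPT value over $\widehat{\mathfrak P}$, is $$c_{\rm DR}^*\in\arg\max_{0\le c\le c_{\max}}\underline\Gamma(c)=\arg\max_{0\le c\le c_{\max}}\min_{1\le k\le K}\Gamma_k(c),\qquad x_{\rm DR}^*=c_{\rm DR}^*q_0,$$ and its solution set is nonempty. At fixed $c$, the set of worst-case models (the indices at which the infimum is attained) is $\mathcal I(c)=\arg\min_{1\le k\le K}\Gamma_k(c)$.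 (ii) Suppose further that each $\Gamma_k$ is continuously differentiable on $(0,c_{\max})$ except at a finite set $\mathcal B_k\subset(0,c_{\max})$, and let $\mathcal B=\bigcup_{k=1}^K\mathcal B_k$. Then at least one maximizer of $\underline\Gamma$ over $[0,c_{\max}]$ belongs to $$\mathcal C_{\rm DR}=\{0,c_{\max}\}\cup\mathcal B\cup\bigcup_{k=1}^K\{c\in(0,c_{\max})\setminus\mathcal B:\Gamma_k'(c)=0\}\cup\bigcup_{1\le i<j\le K}\{c\in(0,c_{\max}):\Gamma_i(c)=\Gamma_j(c)\}.$$ (iii) If, in addition to the assumptions of (ii), the sets of stationary points and of intersections appearing in $\mathcal C_{\rm DR}$ are finite, then the robust problem reduces to pointwise comparison over the finite set $\mathcal C_{\rm DR}$: $\max_{0\le c\le c_{\max}}\underline\Gamma(c)=\max_{c\in\mathcal C_{\rm DR}}\underline\Gamma(c)$, and any maximizer of $\underline\Gamma$ over $\mathcal C_{\rm DR}$ is a robust optimum.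
   Context: $\mathbf 1$ is the all-ones vector in $\mathbb R^d$ and $\|\cdot\|_1$ is the $\ell^1$ norm. In the application the $\widehat P_k$ are normal mean-variance mixture laws. Cumulative prospect (CPT) value. Parameters: $0<\alpha_+,\alpha_-\le 1$, $\lambda_\ell>1$, $\delta_+,\delta_->0$. Value functions for $y\ge0$: $u_+(y)=y^{\alpha_+}$ (gains), $u_-(y)=\lambda_\ell y^{\alpha_-}$ (losses). Probability weighting functions: $w^\pm(p)=p^{\delta_\pm}/[p^{\delta_\pm}+(1-p)^{\delta_\pm}]^{1/\delta_\pm}$ for $0\le p\le1$. For a real random variable $Y$ with continuous distribution function $F_Y$, $$V_{\rm CPT}(Y)=\int_0^\infty u_+(y)\,\mathrm d\{-w^+[1-F_Y(y)]\}-\int_{-\infty}^0u_-(-y)\,\mathrm d\{w^-[F_Y(y)]\}.$$ For a general law it is given by the tail-integral form $$V_{\rm CPT}(Y)=\alpha_+\int_0^\infty y^{\alpha_+-1}w^+\{\Pr[Y>y]\}\,\mathrm dy-\lambda_\ell\alpha_-\int_0^\infty y^{\alpha_--1}w^-\{\Pr[Y<-y]\}\,\mathrm dy .$$ $V_{\rm CPT}^{P}$ denotes the CPT value computed when $X\sim P$. *)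

theory Defs
  imports "HOL-Probability.Probability"
begin

definition l1_norm :: "real ^ 'd \<Rightarrow> real" where
  "l1_norm x = (\<Sum>i\<in>UNIV. \<bar>x $ i\<bar>)"

definition argmax_set :: "('a \<Rightarrow> 'b::order) \<Rightarrow> 'a set \<Rightarrow> 'a set" where
  "argmax_set f S = {x. is_arg_max f (\<lambda>x. x \<in> S) x}"

definition argmin_set :: "('a \<Rightarrow> 'b::order) \<Rightarrow> 'a set \<Rightarrow> 'a set" where
  "argmin_set f S = {x. is_arg_min f (\<lambda>x. x \<in> S) x}"

definition prob_weight :: "real \<Rightarrow> real \<Rightarrow> real" where
  "prob_weight \<delta> p = p powr \<delta> / (p powr \<delta> + (1 - p) powr \<delta>) powr (1 / \<delta>)"

(* Tail-integral form, which makes sense for every law, in particular for point masses.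
   Both integrals are taken in [0, \<infinity>] and subtracted in ereal.  Since \<infinity> - a = \<infinity> for every a
   and a - \<infinity> = -\<infinity> for finite a, the value is finite exactly when both integrals are. *)
definition cpt_gain :: "real \<Rightarrow> real \<Rightarrow> 'a measure \<Rightarrow> ('a \<Rightarrow> real) \<Rightarrow> ennreal" where
  "cpt_gain \<alpha> \<delta> M Y = ennreal \<alpha> *
     (\<integral>\<^sup>+y\<in>{0<..}. ennreal (y powr (\<alpha> - 1) * prob_weight \<delta> (\<P>(\<omega> in M. Y \<omega> > y))) \<partial>lborel)"

definition cpt_loss :: "real \<Rightarrow> real \<Rightarrow> real \<Rightarrow> 'a measure \<Rightarrow> ('a \<Rightarrow> real) \<Rightarrow> ennreal" where
  "cpt_loss \<alpha> l \<delta> M Y = ennreal (l * \<alpha>) *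
     (\<integral>\<^sup>+y\<in>{0<..}. ennreal (y powr (\<alpha> - 1) * prob_weight \<delta> (\<P>(\<omega> in M. Y \<omega> < - y))) \<partial>lborel)"

definition cpt_value ::
  "real \<Rightarrow> real \<Rightarrow> real \<Rightarrow> real \<Rightarrow> real \<Rightarrow> 'a measure \<Rightarrow> ('a \<Rightarrow> real) \<Rightarrow> ereal" where
  "cpt_value \<alpha>p \<alpha>m l \<delta>p \<delta>m M Y =
     enn2ereal (cpt_gain \<alpha>p \<delta>p M Y) - enn2ereal (cpt_loss \<alpha>m l \<delta>m M Y)"

(* The value depends only on the law: a random vector X with law distr M N X may be
   replaced by the identity on the probability space given by its law. *)
lemma cpt_value_distr:
  assumes X: "X \<in> measurable M N" and Y: "Y \<in> borel_measurable N"
  shows "cpt_value \<alpha>p \<alpha>m l \<delta>p \<delta>m (distr M N X) Y = cpt_value \<alpha>p \<alpha>m l \<delta>p \<delta>m M (\<lambda>\<omega>. Y (X \<omega>))"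
proof -
  have *: "\<P>(\<omega> in distr M N X. Y \<omega> \<in> S) = \<P>(\<omega> in M. Y (X \<omega>) \<in> S)" if "S \<in> sets borel" for S
  proof -
    have "{\<omega> \<in> space N. Y \<omega> \<in> S} \<in> sets N"
      using Y that by measurable
    moreover have "X -` {\<omega> \<in> space N. Y \<omega> \<in> S} \<inter> space M = {\<omega> \<in> space M. Y (X \<omega>) \<in> S}"
      using measurable_space[OF X] by auto
    ultimately show ?thesis
      using X by (simp add: measure_distr)
  qed
  show ?thesis
    using *[of "{_<..}"] *[of "{..<_}"] by (simp add: cpt_value_def cpt_gain_def cpt_loss_def)
qed

end

theory Submission
  imports Defs
begin

text \<open>A maximizer of the lower envelope outside \<open>{0, cmax}\<close>, the kinks and the intersections has a
  single active branch. By continuity that branch stays active nearby, so the maximizer is a local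
  maximum of one differentiable function and Fermat's theorem makes it stationary. Thus every
  maximizer lies in the candidate set, not just one.\<close>

lemma argmax_set_iff:
  fixes f :: "'a \<Rightarrow> 'b::linorder"
  shows "x \<in> argmax_set f S \<longleftrightarrow> x \<in> S \<and> (\<forall>y\<in>S. f y \<le> f x)"
  by (auto simp: argmax_set_def is_arg_max_linorder)

lemma argmin_set_iff:
  fixes f :: "'a \<Rightarrow> 'b::linorder"
  shows "x \<in> argmin_set f S \<longleftrightarrow> x \<in> S \<and> (\<forall>y\<in>S. f x \<le> f y)"
  by (auto simp: argmin_set_def is_arg_min_linorder)

text \<open>Both sides compare the same values \<open>f (g x)\<close>. This carries the problem over
  portfolios on the ray to the scalar problem in \<open>c\<close>.\<close>

lemma argmax_set_image:
  fixes f :: "'b \<Rightarrow> 'c::linorder"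
  shows "argmax_set f (g ` S) = g ` argmax_set (\<lambda>x. f (g x)) S"
  by (auto simp: argmax_set_iff)

text \<open>The best value over \<open>S\<close> is already reached inside \<open>T\<close>, so a
  point that is best in \<open>T\<close> does at least as well as every point of \<open>S\<close>.
  With the candidate set as \<open>T\<close>, comparing candidates yields a global optimum.\<close>

lemma argmax_set_mono:
  fixes f :: "'a \<Rightarrow> 'b::linorder"
  assumes "T \<subseteq> S" "argmax_set f S \<inter> T \<noteq> {}"
  shows "argmax_set f T \<subseteq> argmax_set f S"
proof
  obtain c where c: "c \<in> T" "\<And>y. y \<in> S \<Longrightarrow> f y \<le> f c"
    using assms(2) unfolding argmax_set_iff ex_in_conv[symmetric] Int_iff by blast
  fix x assume "x \<in> argmax_set f T"
  then have "x \<in> S" "f c \<le> f x"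
    using c(1) assms(1) by (auto simp: argmax_set_iff)
  then show "x \<in> argmax_set f S"
    using c(2) order_trans unfolding argmax_set_iff by blast
qed

lemma SUP_eq_Max_argmax_set:
  fixes f :: "'a \<Rightarrow> 'b::{complete_lattice, linorder}"
  assumes "finite T" "T \<subseteq> S" "argmax_set f S \<inter> T \<noteq> {}"
  shows "(SUP x\<in>S. f x) = Max (f ` T)"
proof -
  obtain c where c: "c \<in> T" "\<And>y. y \<in> S \<Longrightarrow> f y \<le> f c"
    using assms(3) unfolding argmax_set_iff ex_in_conv[symmetric] Int_iff by blast
  have "(SUP x\<in>S. f x) = f c"
    using c assms(2) by (intro antisym SUP_least SUP_upper) auto
  also have "\<dots> = Max (f ` T)"
    using c assms(1,2) by (intro Max_eqI[symmetric]) auto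
  finally show ?thesis .
qed

text \<open>Adding one index replaces the envelope by a binary \<open>min\<close>. The codomain is
  any linear order topology so that the \<open>ereal\<close>-valued branches are covered.\<close>

lemma continuous_on_Min_image:
  fixes f :: "'k \<Rightarrow> 'a::topological_space \<Rightarrow> 'b::linorder_topology"
  assumes "finite A" "A \<noteq> {}" "\<And>k. k \<in> A \<Longrightarrow> continuous_on S (f k)"
  shows "continuous_on S (\<lambda>x. Min ((\<lambda>k. f k x) ` A))"
  using assms by (induction A rule: finite_ne_induct) (auto intro!: continuous_on_min)

text \<open>The finitely many strict inequalities at \<open>c\<close> persist on a common
  neighbourhood, where branch \<open>k\<close> alone forms the envelope, so Fermat's theorem applies
  to it. The assumption \<open>max\<close> bounds the envelope at \<open>x\<close> by its value at
  \<open>c\<close>, naming a branch below the bound in place of \<open>Min\<close>.\<close>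

lemma deriv_eq_0_at_max_of_active_branch:
  fixes f :: "'k \<Rightarrow> real \<Rightarrow> real"
  assumes A: "finite A" "k \<in> A"
    and S: "open S" "c \<in> S"
    and cont: "\<And>j. j \<in> A \<Longrightarrow> isCont (f j) c"
    and active: "\<And>j. j \<in> A - {k} \<Longrightarrow> f k c < f j c"
    and max: "\<And>x. x \<in> S \<Longrightarrow> \<exists>j\<in>A. f j x \<le> f k c"
    and diff: "f k differentiable at c"
  shows "deriv (f k) c = 0"
proof -
  have "\<forall>\<^sub>F x in nhds c. f k x < f j x" if "j \<in> A - {k}" for j
  proof -
    have "((\<lambda>x. f j x - f k x) \<longlongrightarrow> f j c - f k c) (nhds c)"
      using cont[of j] cont[of k] that A(2) by (intro tendsto_diff) (auto simp: isCont_def tendsto_at_iff_tendsto_nhds)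
    from order_tendstoD(1)[OF this, of 0] show ?thesis
      using active[OF that] by simp
  qed
  then have "\<forall>\<^sub>F x in nhds c. \<forall>j\<in>A - {k}. f k x < f j x"
    using A(1) by (simp add: eventually_ball_finite_distrib)
  moreover have "\<forall>\<^sub>F x in nhds c. x \<in> S"
    using S by (rule eventually_nhds_in_open)
  ultimately have "\<forall>\<^sub>F x in nhds c. f k x \<le> f k c"
  proof eventually_elim
    case (elim x)
    \<comment> \<open>The branch \<open>j\<close> supplied by \<open>max\<close> is either
      \<open>k\<close> itself, or \<open>f k x < f j x \<le> f k c\<close>.\<close>
    with max[of x] show ?case
      by (metis Diff_iff less_le_trans less_imp_le singletonD)
  qed
  then obtain d where d: "d > 0" "\<And>y. \<bar>c - y\<bar> < d \<Longrightarrow> f k y \<le> f k c"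
    by (auto simp: eventually_nhds_metric dist_real_def abs_minus_commute)
  have "DERIV (f k) c :> deriv (f k) c"
    using diff by (simp add: DERIV_deriv_iff_real_differentiable)
  from DERIV_local_max[OF this d(1)] d(2) show ?thesis by blast
qed

text \<open>The values \<open>\<Gamma>\<close> are extended reals, so infima and suprema always
  exist. Their real parts \<open>\<gamma>\<close> carry the derivatives, and \<open>J\<close> is the
  worst-case objective on portfolios.\<close>

theorem proposition2:
  fixes \<alpha>p \<alpha>m l \<delta>p \<delta>m :: real
    and K :: nat
    and P :: "nat \<Rightarrow> (real ^ 'd) measure"
    and q0 :: "real ^ 'd"
    and rf r0 L :: real
    and B :: "nat \<Rightarrow> real set"
  defines "V \<equiv> cpt_value \<alpha>p \<alpha>m l \<delta>p \<delta>m"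
    and "PP \<equiv> P ` {1..K}"
    and "cmax \<equiv> L / l1_norm q0"
    and "\<eta> \<equiv> (\<lambda>X. q0 \<bullet> (X - rf *\<^sub>R 1))"
  defines "\<Gamma> \<equiv> (\<lambda>k c. V (P k) (\<lambda>X. rf - r0 + c * \<eta> X))"
    and "\<Gamma>low \<equiv> (\<lambda>c. INF Q\<in>PP. V Q (\<lambda>X. rf - r0 + c * \<eta> X))"
    and "J \<equiv> (\<lambda>x. INF Q\<in>PP. V Q (\<lambda>X. rf - r0 + x \<bullet> (X - rf *\<^sub>R 1)))"
  defines "\<gamma> \<equiv> (\<lambda>k c. real_of_ereal (\<Gamma> k c))"
    and "BB \<equiv> (\<Union>k\<in>{1..K}. B k)"
  defines "Stat \<equiv> (\<Union>k\<in>{1..K}. {c \<in> {0<..<cmax} - BB. deriv (\<gamma> k) c = 0})"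
    and "Inters \<equiv> (\<Union>i\<in>{1..K}. \<Union>j\<in>{i<..K}. {c \<in> {0<..<cmax}. \<Gamma> i c = \<Gamma> j c})"
  defines "C \<equiv> {0, cmax} \<union> BB \<union> Stat \<union> Inters"
  assumes params: "0 < \<alpha>p" "\<alpha>p \<le> 1" "0 < \<alpha>m" "\<alpha>m \<le> 1" "l > 1" "\<delta>p > 0" "\<delta>m > 0"
    and K: "K \<ge> 1"
    and laws: "\<And>k. k \<in> {1..K} \<Longrightarrow> prob_space (P k) \<and> sets (P k) = sets borel"
    and q0: "q0 \<noteq> 0"
    and L: "L > 0"
    and cmax_pos: "0 < cmax"
    and finite_value: "\<And>k c. k \<in> {1..K} \<Longrightarrow> c \<in> {0..cmax} \<Longrightarrow> \<bar>\<Gamma> k c\<bar> \<noteq> \<infinity>"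
    and cont: "\<And>k. k \<in> {1..K} \<Longrightarrow> continuous_on {0..cmax} (\<Gamma> k)"
  shows
    "((\<forall>c\<in>{0..cmax}. \<Gamma>low c = Min ((\<lambda>k. \<Gamma> k c) ` {1..K})) \<and>
      argmax_set \<Gamma>low {0..cmax} = argmax_set (\<lambda>c. Min ((\<lambda>k. \<Gamma> k c) ` {1..K})) {0..cmax} \<and>
      argmax_set J ((\<lambda>c. c *\<^sub>R q0) ` {0..cmax}) = (\<lambda>c. c *\<^sub>R q0) ` argmax_set \<Gamma>low {0..cmax} \<and>
      argmax_set \<Gamma>low {0..cmax} \<noteq> {} \<and>
      (\<forall>c\<in>{0..cmax}. {k \<in> {1..K}. \<Gamma> k c = \<Gamma>low c} = argmin_set (\<lambda>k. \<Gamma> k c) {1..K}))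
     \<and>
     ((\<forall>k\<in>{1..K}. finite (B k) \<and> B k \<subseteq> {0<..<cmax} \<and>
          \<gamma> k C1_differentiable_on ({0<..<cmax} - B k)) \<longrightarrow>
      argmax_set \<Gamma>low {0..cmax} \<inter> C \<noteq> {} \<and>
      (finite Stat \<and> finite Inters \<longrightarrow>
        finite C \<and>
        (SUP c\<in>{0..cmax}. \<Gamma>low c) = Max (\<Gamma>low ` C) \<and>
        argmax_set \<Gamma>low C \<subseteq> argmax_set \<Gamma>low {0..cmax}))"
proof -
  have A: "finite {1..K}" "{1..K} \<noteq> {}"
    using K by auto
  \<comment> \<open>The infimum runs over a finite nonempty set of laws; writing it as an image
    reindexes it by \<open>k\<close>.\<close>
  have low: "\<Gamma>low c = Min ((\<lambda>k. \<Gamma> k c) ` {1..K})" for c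
    using A unfolding \<Gamma>low_def PP_def \<Gamma>_def by (simp add: Min_Inf image_image)
  have low_le: "\<Gamma>low c \<le> \<Gamma> k c" if "k \<in> {1..K}" for k c
    using that by (simp add: low)
  have low_attained: "\<exists>k\<in>{1..K}. \<Gamma>low c = \<Gamma> k c" for c
    using Min_in[of "(\<lambda>k. \<Gamma> k c) ` {1..K}"] A unfolding low by blast
  have J: "J (c *\<^sub>R q0) = \<Gamma>low c" for c
    by (simp add: J_def \<Gamma>low_def \<eta>_def)
  \<comment> \<open>Existence of a maximizer is the extreme value theorem for the envelope, applied
    directly in \<open>ereal\<close>.\<close>
  have "continuous_on {0..cmax} \<Gamma>low"
    using continuous_on_Min_image[OF A cont] by (simp add: low[abs_def])
  moreover have "compact {0..cmax}" "{0..cmax} \<noteq> {}"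
    using cmax_pos by auto
  ultimately have "\<exists>c\<in>{0..cmax}. \<forall>y\<in>{0..cmax}. \<Gamma>low y \<le> \<Gamma>low c"
    by (rule continuous_attains_sup[rotated 2])
  then have ex: "argmax_set \<Gamma>low {0..cmax} \<noteq> {}"
    unfolding argmax_set_iff ex_in_conv[symmetric] by blast
  have worst: "{k \<in> {1..K}. \<Gamma> k c = \<Gamma>low c} = argmin_set (\<lambda>k. \<Gamma> k c) {1..K}" for c
  proof -
    \<comment> \<open>The envelope is a lower bound of all branches and equals one of them, so
      meeting it is the same as being a smallest branch.\<close>
    have "\<Gamma> k c = \<Gamma>low c \<longleftrightarrow> (\<forall>j\<in>{1..K}. \<Gamma> k c \<le> \<Gamma> j c)" if "k \<in> {1..K}" for k
      using low_le low_attained[of c] that by (metis antisym)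
    then show ?thesis
      unfolding set_eq_iff argmin_set_iff mem_Collect_eq by blast
  qed

  have critical: "argmax_set \<Gamma>low {0..cmax} \<subseteq> C"
    if smooth: "\<forall>k\<in>{1..K}. finite (B k) \<and> B k \<subseteq> {0<..<cmax} \<and>
          \<gamma> k C1_differentiable_on ({0<..<cmax} - B k)"
  proof (rule subsetI, rule ccontr)
    fix c assume c: "c \<in> argmax_set \<Gamma>low {0..cmax}" and "c \<notin> C"
    then have cin: "c \<in> {0<..<cmax}" and not_B: "c \<notin> BB"
      and not_Stat: "c \<notin> Stat" and not_Inters: "c \<notin> Inters"
      using cmax_pos unfolding C_def argmax_set_iff by (auto simp: less_le)
    \<comment> \<open>Finiteness makes \<open>real_of_ereal\<close> faithful here, so comparisons
      pass freely between \<open>\<Gamma>\<close> and \<open>\<gamma>\<close>.\<close>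
    have real: "\<Gamma> j x = ereal (\<gamma> j x)" if "j \<in> {1..K}" "x \<in> {0<..<cmax}" for j x
      using finite_value[of j x] that by (simp add: \<gamma>_def ereal_real)
    obtain k where k: "k \<in> {1..K}" "\<Gamma>low c = \<Gamma> k c"
      using low_attained by blast
    have ne: "\<Gamma> j c \<noteq> \<Gamma> k c" if "j \<in> {1..K} - {k}" for j
    proof
      assume eq: "\<Gamma> j c = \<Gamma> k c"
      \<comment> \<open>\<open>Inters\<close> lists each pair of indices once, smaller index first,
        so both orders of \<open>j\<close> and \<open>k\<close> have to be considered.\<close>
      have "j \<in> {1..K}" "j \<in> {k<..K} \<or> k \<in> {j<..K}"
        using that k(1) by auto
      with eq k(1) cin have "c \<in> Inters"
        unfolding Inters_def by (metis (mono_tags, lifting) UN_I mem_Collect_eq)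
      with not_Inters show False ..
    qed
    have "deriv (\<gamma> k) c = 0"
    proof (rule deriv_eq_0_at_max_of_active_branch[OF A(1) k(1) open_greaterThanLessThan cin])
      fix j assume j: "j \<in> {1..K}"
      \<comment> \<open>Continuity on the closed interval becomes two-sided at an interior point,
        and it survives \<open>real_of_ereal\<close> because the limit is finite.\<close>
      have "isCont (\<Gamma> j) c"
        using cont[OF j] cin by (intro continuous_on_interior[of "{0..cmax}"]) auto
      then have "(\<Gamma> j \<longlongrightarrow> ereal (\<gamma> j c)) (at c)"
        unfolding isCont_def real[OF j cin] .
      then show "isCont (\<gamma> j) c"
        unfolding isCont_def \<gamma>_def by (rule lim_real_of_ereal)
    next
      fix j assume j: "j \<in> {1..K} - {k}"
      then have "\<Gamma> k c < \<Gamma> j c"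
        using low_le[of j c] ne[OF j] k(2) by (simp add: order_less_le)
      then show "\<gamma> k c < \<gamma> j c"
        using real[OF _ cin] j k(1) by simp
    next
      fix x assume x: "x \<in> {0<..<cmax}"
      obtain j where j: "j \<in> {1..K}" "\<Gamma>low x = \<Gamma> j x"
        using low_attained by blast
      have "\<Gamma>low x \<le> \<Gamma>low c"
        using c x unfolding argmax_set_iff by simp
      then have "\<Gamma> j x \<le> \<Gamma> k c"
        using j(2) k(2) by simp
      then show "\<exists>j\<in>{1..K}. \<gamma> j x \<le> \<gamma> k c"
        using real[OF j(1) x] real[OF k(1) cin] j(1) by auto
    next
      \<comment> \<open>Avoiding all kinks in \<open>BB\<close> means in particular avoiding those
        of the active branch.\<close>
      have "\<gamma> k C1_differentiable_on ({0<..<cmax} - B k)" "c \<in> {0<..<cmax} - B k"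
        using smooth k(1) cin not_B by (auto simp: BB_def)
      then show "\<gamma> k differentiable at c"
        by (auto simp: C1_differentiable_on_eq)
    qed
    then have "c \<in> Stat"
      using k(1) cin not_B by (auto simp: Stat_def)
    with not_Stat show False ..
  qed

  show ?thesis
  proof (intro conjI impI ballI)
    show "\<Gamma>low c = Min ((\<lambda>k. \<Gamma> k c) ` {1..K})" for c
      by (rule low)
    show "{k \<in> {1..K}. \<Gamma> k c = \<Gamma>low c} = argmin_set (\<lambda>k. \<Gamma> k c) {1..K}" for c
      by (rule worst)
    show "argmax_set \<Gamma>low {0..cmax} \<noteq> {}"
      by (rule ex)
    show "argmax_set J ((\<lambda>c. c *\<^sub>R q0) ` {0..cmax}) = (\<lambda>c. c *\<^sub>R q0) ` argmax_set \<Gamma>low {0..cmax}"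
      by (simp only: argmax_set_image J)
    show "argmax_set \<Gamma>low {0..cmax} = argmax_set (\<lambda>c. Min ((\<lambda>k. \<Gamma> k c) ` {1..K})) {0..cmax}"
      unfolding low ..
  next
    assume smooth: "\<forall>k\<in>{1..K}. finite (B k) \<and> B k \<subseteq> {0<..<cmax} \<and>
          \<gamma> k C1_differentiable_on ({0<..<cmax} - B k)"
    \<comment> \<open>The maximizers form a nonempty set contained in \<open>C\<close>.\<close>
    show meets: "argmax_set \<Gamma>low {0..cmax} \<inter> C \<noteq> {}"
      using critical[OF smooth] ex by (simp add: Int_absorb2)
    have "BB \<union> Stat \<union> Inters \<subseteq> {0<..<cmax}"
      using smooth unfolding BB_def Stat_def Inters_def by blast
    \<comment> \<open>All candidates are feasible, so the maximum over \<open>C\<close> cannot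
      exceed the maximum over the interval.\<close>
    then have C_sub: "C \<subseteq> {0..cmax}"
      using cmax_pos greaterThanLessThan_subseteq_atLeastAtMost_iff[of 0 cmax 0 cmax]
      unfolding C_def by auto
    show "argmax_set \<Gamma>low C \<subseteq> argmax_set \<Gamma>low {0..cmax}"
      using C_sub meets by (rule argmax_set_mono)
    assume "finite Stat \<and> finite Inters"
    moreover have "finite BB"
      using smooth unfolding BB_def by blast
    ultimately show fin: "finite C"
      by (simp add: C_def)
    show "(SUP c\<in>{0..cmax}. \<Gamma>low c) = Max (\<Gamma>low ` C)"
      using fin C_sub meets by (rule SUP_eq_Max_argmax_set)
  qed
qed

end
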